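(* Let $F$ be a field of prime characteristic $p$, let $n\ge 1$, and let $R:\mathfrak{h}(n)\to\mathfrak{gl}(V)$ be a faithful irreducible finite dimensional representation over $F$. Assume each of $z,x_1,\dots,x_n,y_1,\dots,y_n$ acts on $V$ with at least one eigenvalue in $F$, say $\alpha,\beta_1,\dots,\beta_n,\gamma_1,\dots,\gamma_n\in F$, respectively (this is automatic if $F$ is algebraically closed). Then $V$ is isomorphic, as an $\mathfrak{h}(n)$-module, to $V_{\alpha,\beta_1,\dots,\beta_n,\gamma_1,\dots,\gamma_n}$.
   Context: For $n\ge 1$, the Heisenberg algebra $\mathfrak{h}(n)=\mathfrak{h}(n,F)$ is the Lie algebra over $F$ with basis $x_1,\dots,x_n,y_1,\dots,y_n,z$ and brackets $[x_i,y_i]=z$ for $1\le i\le n$, all other brackets between basis elements (apart from $[y_i,x_i]=-z$) being zero. For $\alpha,\beta_1,\dots,\beta_n,\gamma_1,\dots,\gamma_n\in F$ with $\alpha\ne 0$, the polynomial algebra $F[X_1,\dots,X_n]$ is an $\mathfrak{h}(n)$-module via $z\mapsto\alpha\cdot I$, $x_i\mapsto\beta_i\cdot I+\alpha\cdot\partial/\partial X_i$, $y_i\mapsto\gamma_i\cdot I+m_{X_i}$, where $m_{X_i}$ is multiplication by $X_i$. When $F$ has prime characteristic $p$, the ideal $(X_1^p,\dots,X_n^p)$ is an $\mathfrak{h}(n)$-submodule, and $V_{\alpha,\beta_1,\dots,\beta_n,\gamma_1,\dots,\gamma_n}$ denotes the quotient module $F[X_1,\dots,X_n]/(X_1^p,\dots,X_n^p)$,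 of dimension $p^n$. (Under the hypotheses of the claim, the eigenvalue $\alpha$ is necessarily nonzero, so that the module in the conclusion makes sense; this is part of what is to be proved.) *)

theory Defs
  imports "HOL-Analysis.Analysis" "HOL-Library.Poly_Mapping"
begin

section \<open>Lie algebras and their representations\<close>

locale lie_algebra = vector_space scale
  for scale :: "'f::field \<Rightarrow> 'g::ab_group_add \<Rightarrow> 'g" +
  fixes bracket :: "'g \<Rightarrow> 'g \<Rightarrow> 'g"
  assumes bracket_add_left: "bracket (u + v) w = bracket u w + bracket v w"
    and bracket_add_right: "bracket u (v + w) = bracket u v + bracket u w"
    and bracket_scale_left: "bracket (scale c u) v = scale c (bracket u v)"
    and bracket_scale_right: "bracket u (scale c v) = scale c (bracket u v)"
    and bracket_self: "bracket u u = 0"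
    and jacobi: "bracket u (bracket v w) + bracket v (bracket w u) + bracket w (bracket u v) = 0"

text \<open>
  A representation is a Lie algebra homomorphism into the linear endomorphisms of \<open>V\<close> with the
  commutator bracket; the vector space operations on endomorphisms are written out pointwise.
\<close>

locale lie_representation =
  L: lie_algebra scaleL bracket + V: vector_space scaleV
  for scaleL :: "'f::field \<Rightarrow> 'g::ab_group_add \<Rightarrow> 'g"
    and bracket :: "'g \<Rightarrow> 'g \<Rightarrow> 'g"
    and scaleV :: "'f \<Rightarrow> 'v::ab_group_add \<Rightarrow> 'v" +
  fixes R :: "'g \<Rightarrow> 'v \<Rightarrow> 'v"
  assumes rep_linear: "Vector_Spaces.linear scaleV scaleV (R u)"
    and rep_add: "R (u + w) v = R u v + R w v"
    and rep_scale: "R (scaleL c u) v = scaleV c (R u v)"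
    and rep_bracket: "R (bracket u w) v = R u (R w v) - R w (R u v)"
begin

definition faithful :: bool where
  "faithful \<longleftrightarrow> inj R"

definition invariant_subspace :: "'v set \<Rightarrow> bool" where
  "invariant_subspace W \<longleftrightarrow> V.subspace W \<and> (\<forall>u. \<forall>v\<in>W. R u v \<in> W)"

definition irreducible_rep :: bool where
  "irreducible_rep \<longleftrightarrow>
     (UNIV :: 'v set) \<noteq> {0} \<and> (\<forall>W. invariant_subspace W \<longrightarrow> W = {0} \<or> W = UNIV)"

definition finite_dimensional_rep :: bool where
  "finite_dimensional_rep \<longleftrightarrow> (\<exists>B. finite_dimensional_vector_space scaleV B)"

end

definition rep_isomorphic ::
  "('f::field \<Rightarrow> 'v::ab_group_add \<Rightarrow> 'v) \<Rightarrow> ('g \<Rightarrow> 'v \<Rightarrow> 'v) \<Rightarrow>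
   ('f \<Rightarrow> 'w::ab_group_add \<Rightarrow> 'w) \<Rightarrow> ('g \<Rightarrow> 'w \<Rightarrow> 'w) \<Rightarrow> bool" where
  "rep_isomorphic scaleV R scaleW S \<longleftrightarrow>
     (\<exists>\<phi>. Vector_Spaces.linear scaleV scaleW \<phi> \<and> bij \<phi> \<and> (\<forall>u v. \<phi> (R u v) = S u (\<phi> v)))"

definition is_eigenvalue ::
  "('f::field \<Rightarrow> 'v::ab_group_add \<Rightarrow> 'v) \<Rightarrow> ('v \<Rightarrow> 'v) \<Rightarrow> 'f \<Rightarrow> bool" where
  "is_eigenvalue scaleV T c \<longleftrightarrow> (\<exists>v. v \<noteq> 0 \<and> T v = scaleV c v)"


section \<open>The Heisenberg algebra\<close>

text \<open>
  The triple \<open>(a, b, t)\<close> stands for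
  \<open>(\<Sum>i. a\<^sub>i x\<^sub>i) + (\<Sum>i. b\<^sub>i y\<^sub>i) + t z\<close>, where the indices \<open>1, \<dots>, n\<close>
  are the elements of the finite (hence nonempty) type \<open>'n\<close>.
\<close>

type_synonym ('f, 'n) heis = "('f ^ 'n) \<times> ('f ^ 'n) \<times> 'f"

definition heis_scale :: "'f::field \<Rightarrow> ('f, 'n::finite) heis \<Rightarrow> ('f, 'n) heis" where
  "heis_scale c = (\<lambda>(a, b, t). (c *s a, c *s b, c * t))"

definition heis_bracket ::
  "('f::field, 'n::finite) heis \<Rightarrow> ('f, 'n) heis \<Rightarrow> ('f, 'n) heis" where
  "heis_bracket = (\<lambda>(a, b, t) (a', b', t'). (0, 0, \<Sum>i\<in>UNIV. a $ i * b' $ i - a' $ i * b $ i))"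

definition heis_x :: "'n \<Rightarrow> ('f::field, 'n::finite) heis" where
  "heis_x i = (axis i 1, 0, 0)"

definition heis_y :: "'n \<Rightarrow> ('f::field, 'n::finite) heis" where
  "heis_y i = (0, axis i 1, 0)"

definition heis_z :: "('f::field, 'n::finite) heis" where
  "heis_z = (0, 0, 1)"

lemma heis_bracket_basis:
  "heis_bracket (heis_x i) (heis_y j) = (if i = j then heis_z else 0)"
  "heis_bracket (heis_y j) (heis_x i) = (if i = j then - heis_z else 0)"
  "heis_bracket (heis_x i) (heis_x j) = 0"
  "heis_bracket (heis_y i) (heis_y j) = 0"
  "heis_bracket heis_z u = 0"
  "heis_bracket u heis_z = 0"
  by (cases u; auto simp: heis_bracket_def heis_x_def heis_y_def heis_z_def axis_def zero_prod_def
        if_distrib[where f = "\<lambda>x. x * _"] sum_negf cong: if_cong)+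

lemma heis_basis_expansion:
  fixes a b :: "'f::field ^ 'n::finite"
  shows "(\<Sum>i\<in>UNIV. heis_scale (a $ i) (heis_x i)) + (\<Sum>i\<in>UNIV. heis_scale (b $ i) (heis_y i))
           + heis_scale t heis_z = (a, b, t)"
proof -
  have x: "(\<Sum>i\<in>UNIV. heis_scale (a $ i) (heis_x i)) = (a, 0, 0)"
    by (auto simp: heis_scale_def heis_x_def sum_prod basis_expansion)
  have y: "(\<Sum>i\<in>UNIV. heis_scale (b $ i) (heis_y i)) = (0, b, 0)"
    by (auto simp: heis_scale_def heis_y_def sum_prod basis_expansion)
  show ?thesis
    unfolding x y by (simp add: heis_scale_def heis_z_def)
qed

lemma heis_lie_algebra:
  "lie_algebra heis_scale (heis_bracket :: ('f::field, 'n::finite) heis \<Rightarrow> _)"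
  by unfold_locales
     (auto simp: heis_scale_def heis_bracket_def algebra_simps vec.scale_right_distrib
        vec.scale_left_distrib sum.distrib sum_subtractf sum_distrib_left zero_prod_def)


section \<open>Polynomials\<close>

text \<open>
  A polynomial in the variables \<open>X\<^sub>i\<close>, \<open>i :: 'n\<close>, is a finitely supported map from exponent
  vectors to coefficients; the product on \<open>poly_mapping\<close> is the convolution product.
\<close>

type_synonym ('f, 'n) mpolynomial = "('n \<Rightarrow>\<^sub>0 nat) \<Rightarrow>\<^sub>0 'f"

definition poly_scale :: "'f::field \<Rightarrow> ('f, 'n) mpolynomial \<Rightarrow> ('f, 'n) mpolynomial" where
  "poly_scale c P = Poly_Mapping.single 0 c * P"

definition indet :: "'n \<Rightarrow> ('f::field, 'n) mpolynomial" where
  "indet i = Poly_Mapping.single (Poly_Mapping.single i 1) 1"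

definition partial :: "'n \<Rightarrow> ('f::field, 'n) mpolynomial \<Rightarrow> ('f, 'n) mpolynomial" where
  "partial i P = (\<Sum>m\<in>Poly_Mapping.keys P.
     Poly_Mapping.single (m - Poly_Mapping.single i 1)
       (of_nat (Poly_Mapping.lookup m i) * Poly_Mapping.lookup P m))"

lemma partial_superset:
  assumes "finite A" "Poly_Mapping.keys P \<subseteq> A"
  shows "partial i P = (\<Sum>m\<in>A. Poly_Mapping.single (m - Poly_Mapping.single i 1)
       (of_nat (Poly_Mapping.lookup m i) * Poly_Mapping.lookup P m))"
  unfolding partial_def
  by (rule sum.mono_neutral_left) (use assms in \<open>auto simp: in_keys_iff\<close>)

lemma partial_add: "partial i (P + Q) = partial i P + partial i Q"
proof -
  let ?A = "Poly_Mapping.keys P \<union> Poly_Mapping.keys Q"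
  have "finite ?A" "Poly_Mapping.keys (P + Q) \<subseteq> ?A"
    by (auto simp: keys_add)
  then show ?thesis
    by (subst (1 2 3) partial_superset[of ?A])
       (auto simp: lookup_add single_add ring_distribs sum.distrib)
qed

lemma partial_single:
  "partial i (Poly_Mapping.single m c) =
     Poly_Mapping.single (m - Poly_Mapping.single i 1) (of_nat (Poly_Mapping.lookup m i) * c)"
  by (subst partial_superset[of "{m}"]) auto

lemma partial_0 [simp]: "partial i 0 = 0"
  by (simp add: partial_def)

lemma partial_sum: "partial i (sum P A) = (\<Sum>x\<in>A. partial i (P x))"
  by (induction A rule: infinite_finite_induct) (auto simp: partial_add)

lemma mpolynomial_expansion:
  "P = (\<Sum>m\<in>Poly_Mapping.keys P. Poly_Mapping.single m (Poly_Mapping.lookup P m))"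
  by (rule poly_mapping_eqI)
     (auto simp: lookup_sum lookup_single when_def in_keys_iff)

lemma partial_mult_single:
  "partial i (Poly_Mapping.single m c * Poly_Mapping.single k d) =
     partial i (Poly_Mapping.single m c) * Poly_Mapping.single k d +
     Poly_Mapping.single m c * partial i (Poly_Mapping.single k d)"
proof -
  let ?e = "Poly_Mapping.single i (1::nat)"
  have e: "u - ?e + v = u + v - ?e" if "Poly_Mapping.lookup u i > 0" for u v :: "'a \<Rightarrow>\<^sub>0 nat"
    using that by (intro poly_mapping_eqI) (auto simp: lookup_add lookup_minus lookup_single when_def)
  have "Poly_Mapping.single (m - ?e + k) (of_nat (Poly_Mapping.lookup m i) * c * d) =
        Poly_Mapping.single (m + k - ?e) (of_nat (Poly_Mapping.lookup m i) * c * d)"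
    by (cases "Poly_Mapping.lookup m i = 0") (auto simp: e[unfolded One_nat_def])
  moreover have "Poly_Mapping.single (m + (k - ?e)) (c * (of_nat (Poly_Mapping.lookup k i) * d)) =
        Poly_Mapping.single (m + k - ?e) (c * (of_nat (Poly_Mapping.lookup k i) * d))"
    by (cases "Poly_Mapping.lookup k i = 0") (auto simp: add.commute[of m] e[unfolded One_nat_def])
  ultimately show ?thesis
    by (simp add: partial_single mult_single lookup_add algebra_simps flip: single_add)
qed

lemma partial_mult: "partial i (P * Q) = partial i P * Q + P * partial i Q"
proof -
  have *: "partial i (Poly_Mapping.single m c * Q) =
      partial i (Poly_Mapping.single m c) * Q + Poly_Mapping.single m c * partial i Q" for m c
    by (subst (1 2 3) mpolynomial_expansion[of Q])
       (simp only: sum_distrib_left partial_sum partial_mult_single sum.distrib)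
  show ?thesis
    by (subst (1 2 3) mpolynomial_expansion[of P])
       (simp only: sum_distrib_right partial_sum * sum.distrib)
qed

lemma partial_scale: "partial i (poly_scale c P) = poly_scale c (partial i P)"
  by (simp add: poly_scale_def partial_mult partial_single)

lemma partial_indet: "partial i (indet j) = (if i = j then 1 else 0)"
  by (auto simp: indet_def partial_single lookup_single when_def)

lemma partial_commute: "partial i (partial j P) = partial j (partial i P)"
proof -
  have "partial i (partial j (Poly_Mapping.single m c)) =
        partial j (partial i (Poly_Mapping.single m c))" for m c
    by (auto simp: partial_single lookup_minus lookup_single when_def diff_diff_eq add.commute
          mult.left_commute)
  then show ?thesis
    by (subst (1 2) mpolynomial_expansion[of P]) (simp only: partial_sum, rule sum.cong, simp_all only:)
qed

lemma poly_scale_vector_space: "vector_space (poly_scale :: 'f::field \<Rightarrow> ('f, 'n) mpolynomial \<Rightarrow> _)"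
  by unfold_locales
     (simp_all add: poly_scale_def ring_distribs single_add mult_single flip: mult.assoc)

text \<open>
  The action of \<open>h(n)\<close> on \<open>F[X\<^sub>1, \<dots>, X\<^sub>n]\<close>, extended linearly from
  \<open>x\<^sub>i \<mapsto> \<beta>\<^sub>i I + \<alpha> \<partial>/\<partial>X\<^sub>i\<close>, \<open>y\<^sub>i \<mapsto> \<gamma>\<^sub>i I + m\<^bsub>X\<^sub>i\<^esub>\<close>, \<open>z \<mapsto> \<alpha> I\<close>.
\<close>

definition poly_act ::
  "'f::field \<Rightarrow> ('n::finite \<Rightarrow> 'f) \<Rightarrow> ('n \<Rightarrow> 'f) \<Rightarrow> ('f, 'n) heis \<Rightarrow>
   ('f, 'n) mpolynomial \<Rightarrow> ('f, 'n) mpolynomial" where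
  "poly_act \<alpha> \<beta> \<gamma> = (\<lambda>(a, b, t) P.
     (\<Sum>i\<in>UNIV. poly_scale (a $ i) (poly_scale (\<beta> i) P + poly_scale \<alpha> (partial i P))) +
     (\<Sum>i\<in>UNIV. poly_scale (b $ i) (poly_scale (\<gamma> i) P + indet i * P)) +
     poly_scale t (poly_scale \<alpha> P))"

lemma poly_act_add: "poly_act \<alpha> \<beta> \<gamma> u (P + Q) = poly_act \<alpha> \<beta> \<gamma> u P + poly_act \<alpha> \<beta> \<gamma> u Q"
  by (cases u) (auto simp: poly_act_def poly_scale_def partial_add ring_distribs sum.distrib)

lemma poly_act_scale:
  "poly_act \<alpha> \<beta> \<gamma> u (poly_scale c P) = poly_scale c (poly_act \<alpha> \<beta> \<gamma> u P)"
  by (cases u) (auto simp: poly_act_def partial_scale,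
      simp add: poly_scale_def ring_distribs sum_distrib_left mult.left_commute)

lemma poly_act_diff: "poly_act \<alpha> \<beta> \<gamma> u (P - Q) = poly_act \<alpha> \<beta> \<gamma> u P - poly_act \<alpha> \<beta> \<gamma> u Q"
  using poly_act_add[of \<alpha> \<beta> \<gamma> u "P - Q" Q] by (simp add: algebra_simps)

lemma poly_act_add_left:
  "poly_act \<alpha> \<beta> \<gamma> (u + w) P = poly_act \<alpha> \<beta> \<gamma> u P + poly_act \<alpha> \<beta> \<gamma> w P"
  by (cases u; cases w)
     (auto simp: poly_act_def poly_scale_def single_add ring_distribs sum.distrib)

lemma poly_act_scale_left:
  "poly_act \<alpha> \<beta> \<gamma> (heis_scale c u) P = poly_scale c (poly_act \<alpha> \<beta> \<gamma> u P)"
  for P :: "('f::field, 'n::finite) mpolynomial"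
proof -
  have *: "Poly_Mapping.single 0 (c * d) = Poly_Mapping.single 0 c * (Poly_Mapping.single 0 d)"
    for c d :: 'f by (simp add: mult_single)
  show ?thesis
    by (cases u) (auto simp: poly_act_def poly_scale_def heis_scale_def * ring_distribs
        sum_distrib_left mult.assoc)
qed

lemma poly_act_basis:
  "poly_act \<alpha> \<beta> \<gamma> heis_z P = poly_scale \<alpha> P"
  "poly_act \<alpha> \<beta> \<gamma> (heis_x i) P = poly_scale (\<beta> i) P + poly_scale \<alpha> (partial i P)"
  "poly_act \<alpha> \<beta> \<gamma> (heis_y i) P = poly_scale (\<gamma> i) P + indet i * P"
proof -
  have *: "(\<Sum>j\<in>UNIV. poly_scale (axis i 1 $ j) (f j)) = f i" for f :: "'a \<Rightarrow> ('b, 'a) mpolynomial"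
    by (subst sum.remove[of _ i]) (auto simp: axis_def poly_scale_def intro!: sum.neutral)
  show "poly_act \<alpha> \<beta> \<gamma> heis_z P = poly_scale \<alpha> P"
    "poly_act \<alpha> \<beta> \<gamma> (heis_x i) P = poly_scale (\<beta> i) P + poly_scale \<alpha> (partial i P)"
    "poly_act \<alpha> \<beta> \<gamma> (heis_y i) P = poly_scale (\<gamma> i) P + indet i * P"
    unfolding poly_act_def heis_x_def heis_y_def heis_z_def
    by (simp_all add: *) (simp_all add: poly_scale_def)
qed


lemma poly_act_commutator:
  "poly_act \<alpha> \<beta> \<gamma> (heis_bracket u w) P =
     poly_act \<alpha> \<beta> \<gamma> u (poly_act \<alpha> \<beta> \<gamma> w P) - poly_act \<alpha> \<beta> \<gamma> w (poly_act \<alpha> \<beta> \<gamma> u P)"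
  for P :: "('f::field, 'n::finite) mpolynomial"
proof -
  obtain a b t a' b' t' where uw: "u = (a, b, t)" "w = (a', b', t')"
    by (cases u; cases w)
  define C :: "'f \<Rightarrow> ('f, 'n) mpolynomial" where "C = Poly_Mapping.single 0"
  define D where "D a Q = (\<Sum>i\<in>UNIV. C (a $ i) * C \<alpha> * partial i Q)" for a :: "'f ^ 'n" and Q
  define G where "G a b t = (\<Sum>i\<in>UNIV. C (a $ i) * C (\<beta> i)) + (\<Sum>i\<in>UNIV. C (b $ i) * C (\<gamma> i))
      + (\<Sum>i\<in>UNIV. C (b $ i) * indet i) + C t * C \<alpha>" for a b :: "'f ^ 'n" and t
  have C: "partial i (C c) = 0" "C (c * d) = C c * C d" "C (c - d) = C c - C d" "C 0 = 0"
      "C (sum f A) = (\<Sum>x\<in>A. C (f x))" for i c d f and A :: "'n set"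
    by (simp_all add: C_def partial_single mult_single single_diff)
       (induction A rule: infinite_finite_induct, auto simp: single_add)
  have act: "poly_act \<alpha> \<beta> \<gamma> (a, b, t) Q = D a Q + G a b t * Q" for a b t Q
    by (simp add: poly_act_def poly_scale_def D_def G_def C_def[symmetric] ring_distribs
          sum.distrib sum_distrib_right mult.assoc)
  have D_add: "D a (Q + Q') = D a Q + D a Q'" for a Q Q'
    by (simp add: D_def partial_add ring_distribs sum.distrib)
  have D_mult: "D a (Q * Q') = D a Q * Q' + Q * D a Q'" for a Q Q'
    by (simp add: D_def partial_mult ring_distribs sum.distrib sum_distrib_left sum_distrib_right
          mult.assoc mult.left_commute)
  have D_G: "D a (G a' b t) = C \<alpha> * (\<Sum>i\<in>UNIV. C (a $ i) * C (b $ i))" for a a' b t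
    by (simp add: D_def G_def partial_add partial_sum partial_mult C partial_indet sum_distrib_left
          if_distrib[where f = "\<lambda>x. y * x" for y] mult_ac cong: if_cong)
  have DD: "D a (D a' P) = (\<Sum>i\<in>UNIV. \<Sum>j\<in>UNIV. C (a $ i) * C \<alpha> * (C (a' $ j) * C \<alpha> * partial i (partial j P)))"
    for a a'
    by (simp add: D_def partial_sum partial_mult C sum_distrib_left mult.assoc)
  have D_commute: "D a (D a' P) = D a' (D a P)"
    unfolding DD
    by (subst sum.swap, intro sum.cong refl, subst partial_commute) (simp only: mult_ac)
  have "poly_act \<alpha> \<beta> \<gamma> (heis_bracket u w) P =
      C \<alpha> * ((\<Sum>i\<in>UNIV. C (a $ i) * C (b' $ i)) - (\<Sum>i\<in>UNIV. C (a' $ i) * C (b $ i))) * P"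
    unfolding uw heis_bracket_def prod.case act
    by (simp add: D_def G_def C sum_subtractf mult.commute)
  also have "\<dots> = (D a (G a' b' t') - D a' (G a b t)) * P"
    by (simp add: D_G right_diff_distrib)
  also have "\<dots> = poly_act \<alpha> \<beta> \<gamma> u (poly_act \<alpha> \<beta> \<gamma> w P) - poly_act \<alpha> \<beta> \<gamma> w (poly_act \<alpha> \<beta> \<gamma> u P)"
    unfolding uw act by (simp add: D_add D_mult D_commute algebra_simps)
  finally show ?thesis .
qed


section \<open>The truncated polynomial module\<close>

text \<open>The ideal \<open>(X\<^sub>1\<^sup>p, \<dots>, X\<^sub>n\<^sup>p)\<close>, where \<open>p\<close> is the characteristic of \<open>'f\<close>.\<close>

definition trunc_ideal :: "('f::field, 'n) mpolynomial set" where
  "trunc_ideal = module.span (*) (range (\<lambda>i. indet i ^ CHAR('f)))"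

interpretation mpoly_ideal: module "(*) :: ('f::field, 'n) mpolynomial \<Rightarrow> _"
  by unfold_locales (simp_all add: algebra_simps)

lemma trunc_ideal_closed:
  "0 \<in> trunc_ideal"
  "P \<in> trunc_ideal \<Longrightarrow> Q \<in> trunc_ideal \<Longrightarrow> P + Q \<in> trunc_ideal"
  "P \<in> trunc_ideal \<Longrightarrow> Q \<in> trunc_ideal \<Longrightarrow> P - Q \<in> trunc_ideal"
  "P \<in> trunc_ideal \<Longrightarrow> - P \<in> trunc_ideal"
  "(\<And>x. x \<in> A \<Longrightarrow> f x \<in> trunc_ideal) \<Longrightarrow> sum f A \<in> trunc_ideal"
  "P \<in> trunc_ideal \<Longrightarrow> Q * P \<in> trunc_ideal"
  unfolding trunc_ideal_def
  by (intro mpoly_ideal.span_zero mpoly_ideal.span_add mpoly_ideal.span_diff mpoly_ideal.span_neg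
      mpoly_ideal.span_sum mpoly_ideal.span_scale; simp)+

lemma trunc_ideal_scale: "P \<in> trunc_ideal \<Longrightarrow> poly_scale c P \<in> trunc_ideal"
  by (simp add: poly_scale_def trunc_ideal_closed)

lemma partial_power: "partial i (P ^ k) = of_nat k * P ^ (k - 1) * partial i P"
proof (induction k)
  case 0
  have "partial i (1 :: ('b, 'a) mpolynomial) = 0"
    using partial_single[of i 0 "1 :: 'b"] by simp
  then show ?case by simp
next
  case (Suc k)
  have "P * (of_nat k * P ^ (k - 1)) = of_nat k * P ^ k"
    by (cases k) (simp_all add: mult.left_commute)
  then have "P * partial i (P ^ k) = of_nat k * P ^ k * partial i P"
    by (simp only: Suc.IH mult.assoc[symmetric])
  moreover have "partial i (P ^ Suc k) = partial i P * P ^ k + P * partial i (P ^ k)"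
    by (simp only: power_Suc partial_mult)
  moreover have "partial i P * P ^ k + of_nat k * P ^ k * partial i P =
      of_nat (Suc k) * P ^ k * partial i P"
    by (simp only: of_nat_Suc distrib_right mult_1_left mult.commute[of "partial i P"])
  ultimately show ?case
    by (simp only: diff_Suc_1)
qed

lemma partial_indet_power: "partial i (indet j ^ CHAR('f)) = (0 :: ('f::field, 'n) mpolynomial)"
proof -
  have "(of_nat CHAR('f) :: ('f, 'n) mpolynomial) = 0"
    using single_of_nat[of "CHAR('f)", where ?'b = 'f and ?'a = "'n \<Rightarrow>\<^sub>0 nat"] by (metis of_nat_CHAR single_zero)
  then show ?thesis by (simp add: partial_power)
qed

lemma partial_trunc_ideal: "P \<in> trunc_ideal \<Longrightarrow> partial i P \<in> trunc_ideal"
  for P :: "('f::field, 'n) mpolynomial"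
  unfolding trunc_ideal_def
proof (induction rule: mpoly_ideal.span_induct_alt)
  case base
  show ?case by (simp add: mpoly_ideal.span_zero)
next
  case (step c x y)
  then have "partial i (c * x + y) = partial i c * x + partial i y"
    by (auto simp: partial_add partial_mult partial_indet_power)
  moreover have "partial i c * x + partial i y
      \<in> module.span (*) (range (\<lambda>i. indet i ^ CHAR('f)))"
    by (rule mpoly_ideal.span_add[OF mpoly_ideal.span_scale[OF mpoly_ideal.span_base[OF step(1)]] step(2)])
  ultimately show ?case
    by simp
qed

lemma poly_act_trunc_ideal: "P \<in> trunc_ideal \<Longrightarrow> poly_act \<alpha> \<beta> \<gamma> u P \<in> trunc_ideal"
  by (cases u)
     (auto simp: poly_act_def intro!: trunc_ideal_closed trunc_ideal_scale partial_trunc_ideal)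

definition trunc_rel :: "('f::field, 'n) mpolynomial \<Rightarrow> ('f, 'n) mpolynomial \<Rightarrow> bool" where
  "trunc_rel P Q \<longleftrightarrow> P - Q \<in> trunc_ideal"

quotient_type (overloaded) ('f, 'n) trunc_poly = "('n \<Rightarrow>\<^sub>0 nat) \<Rightarrow>\<^sub>0 ('f::field)" / trunc_rel
proof (rule equivpI)
  show "reflp (trunc_rel :: ('f, 'n) mpolynomial \<Rightarrow> _)"
    by (auto intro!: reflpI simp: trunc_rel_def trunc_ideal_closed)
  show "symp (trunc_rel :: ('f, 'n) mpolynomial \<Rightarrow> _)"
    using trunc_ideal_closed(4) by (fastforce intro!: sympI simp: trunc_rel_def)
  show "transp (trunc_rel :: ('f, 'n) mpolynomial \<Rightarrow> _)"
    using trunc_ideal_closed(2) by (fastforce intro!: transpI simp: trunc_rel_def)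
qed

instantiation trunc_poly :: (field, type) ab_group_add
begin

lift_definition zero_trunc_poly :: "('a, 'b) trunc_poly" is 0 .

lift_definition plus_trunc_poly ::
  "('a, 'b) trunc_poly \<Rightarrow> ('a, 'b) trunc_poly \<Rightarrow> ('a, 'b) trunc_poly" is "(+)"
  unfolding trunc_rel_def by (simp add: add_diff_add trunc_ideal_closed)

lift_definition uminus_trunc_poly :: "('a, 'b) trunc_poly \<Rightarrow> ('a, 'b) trunc_poly" is uminus
  unfolding trunc_rel_def by (metis minus_diff_minus trunc_ideal_closed(4))

lift_definition minus_trunc_poly ::
  "('a, 'b) trunc_poly \<Rightarrow> ('a, 'b) trunc_poly \<Rightarrow> ('a, 'b) trunc_poly" is "(-)"
proof -
  fix P P' Q Q' :: "('a, 'b) mpolynomial"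
  assume "trunc_rel P P'" "trunc_rel Q Q'"
  then have "(P - P') - (Q - Q') \<in> trunc_ideal"
    by (simp add: trunc_rel_def trunc_ideal_closed)
  then show "trunc_rel (P - Q) (P' - Q')"
    by (simp add: trunc_rel_def algebra_simps)
qed

instance
  by standard (transfer; simp add: trunc_rel_def trunc_ideal_closed algebra_simps)+

end

lift_definition trunc_scale :: "'f::field \<Rightarrow> ('f, 'n) trunc_poly \<Rightarrow> ('f, 'n) trunc_poly" is poly_scale
  unfolding trunc_rel_def
  by (metis poly_scale_def right_diff_distrib trunc_ideal_scale)

text \<open>The action on the module \<open>V\<^bsub>\<alpha>,\<beta>\<^sub>1,\<dots>,\<beta>\<^sub>n,\<gamma>\<^sub>1,\<dots>,\<gamma>\<^sub>n\<^esub>\<close>.\<close>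

lift_definition trunc_act ::
  "'f::field \<Rightarrow> ('n::finite \<Rightarrow> 'f) \<Rightarrow> ('n \<Rightarrow> 'f) \<Rightarrow> ('f, 'n) heis \<Rightarrow>
   ('f, 'n) trunc_poly \<Rightarrow> ('f, 'n) trunc_poly" is poly_act
  unfolding trunc_rel_def by (metis poly_act_diff poly_act_trunc_ideal)

lemma trunc_scale_vector_space:
  "vector_space (trunc_scale :: 'f::field \<Rightarrow> ('f, 'n) trunc_poly \<Rightarrow> _)"
proof -
  interpret P: vector_space "poly_scale :: 'f \<Rightarrow> ('f, 'n) mpolynomial \<Rightarrow> _"
    by (rule poly_scale_vector_space)
  show ?thesis
    by unfold_locales
       (transfer; simp add: trunc_rel_def trunc_ideal_closed P.scale_right_distrib
          P.scale_left_distrib)+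
qed

lemma trunc_act_representation:
  "lie_representation heis_scale heis_bracket trunc_scale
     (trunc_act \<alpha> \<beta> \<gamma> :: ('f::field, 'n::finite) heis \<Rightarrow> _)"
proof -
  interpret L: lie_algebra heis_scale "heis_bracket :: ('f, 'n) heis \<Rightarrow> _"
    by (rule heis_lie_algebra)
  interpret V: vector_space "trunc_scale :: 'f \<Rightarrow> ('f, 'n) trunc_poly \<Rightarrow> _"
    by (rule trunc_scale_vector_space)
  show ?thesis
    by unfold_locales
       (transfer; simp add: trunc_rel_def trunc_ideal_closed poly_act_add poly_act_scale
          poly_act_add_left poly_act_scale_left poly_act_commutator)+
qed

end

theory Submission
  imports Defs
begin

text \<open>
  By irreducibility the central element \<open>z\<close> acts as \<open>\<alpha>\<close>, and \<open>\<alpha> \<noteq> 0\<close> by faithfulness. Put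
  \<open>A\<^sub>i = R x\<^sub>i - \<beta>\<^sub>i\<close> and \<open>B\<^sub>i = R y\<^sub>i - \<gamma>\<^sub>i\<close>, so that \<open>[A\<^sub>i, B\<^sub>j] = \<delta>\<^sub>i\<^sub>j \<alpha>\<close>. In characteristic \<open>p\<close>
  the powers \<open>A\<^sub>i\<^sup>p\<close> and \<open>B\<^sub>i\<^sup>p\<close> are central with nonzero kernel, hence vanish, so the commuting
  operators \<open>A\<^sub>i\<close> have a common null vector \<open>v \<noteq> 0\<close>. The map \<open>P \<mapsto> P(B) v\<close> is a module
  homomorphism, onto by irreducibility, and it kills \<open>(X\<^sub>1\<^sup>p, \<dots>, X\<^sub>n\<^sup>p)\<close>. Its kernel is closed under
  \<open>\<partial>/\<partial>X\<^sub>i\<close>; a polynomial with all exponents below \<open>p\<close> whose partial derivatives vanish is constant,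
  so by induction on the degree the kernel contains no nonzero such polynomial.
\<close>

section \<open>Induction over the Heisenberg algebra and over polynomials\<close>

lemma heis_induct [case_names x y z add scale]:
  fixes u :: "('f::field, 'n::finite) heis"
  assumes x: "\<And>i. P (heis_x i)" and y: "\<And>i. P (heis_y i)" and z: "P heis_z"
    and add: "\<And>u w. P u \<Longrightarrow> P w \<Longrightarrow> P (u + w)"
    and scale: "\<And>c u. P u \<Longrightarrow> P (heis_scale c u)"
  shows "P u"
proof -
  have "heis_scale 0 heis_z = (0 :: ('f, 'n) heis)"
    by (simp add: heis_scale_def heis_z_def zero_prod_def)
  then have P0: "P 0"
    using scale[OF z, of 0] by simp
  have P_sum: "P (\<Sum>i\<in>S. f i)" if "\<And>i. P (f i)" for S and f :: "'n \<Rightarrow> ('f, 'n) heis"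
    using that by (induction S rule: infinite_finite_induct) (auto intro: P0 add)
  obtain a b t where u: "u = (a, b, t)"
    by (cases u)
  show ?thesis
    unfolding u heis_basis_expansion[symmetric] by (intro add P_sum scale x y z)
qed

text \<open>The zero polynomial needs no case of its own, being a monomial with coefficient
  0.\<close>

lemma mpolynomial_induct [case_names single add]:
  fixes P :: "('f::field, 'n) mpolynomial"
  assumes single: "\<And>m c. Q (Poly_Mapping.single m c)"
    and add: "\<And>P P'. Q P \<Longrightarrow> Q P' \<Longrightarrow> Q (P + P')"
  shows "Q P"
proof -
  have "Q (\<Sum>m\<in>S. Poly_Mapping.single m (Poly_Mapping.lookup P m))" for S
    using single[of 0 0] by (induction S rule: infinite_finite_induct) (auto intro: assms)
  then show ?thesis
    by (subst mpolynomial_expansion)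
qed

section \<open>Derivatives and normal forms modulo the ideal of p-th powers\<close>

lemma indet_power: "indet i ^ k = Poly_Mapping.single (Poly_Mapping.single i k) 1"
  by (induction k) (simp_all add: indet_def mult_single single_add[symmetric])

text \<open>Read off by coefficients, differentiation involves no truncated subtraction of
  exponents: where the subtraction in \<open>partial\<close> would truncate, its numerical factor is
  0.\<close>

lemma lookup_partial:
  "Poly_Mapping.lookup (partial i P) m =
     of_nat (Suc (Poly_Mapping.lookup m i)) * Poly_Mapping.lookup P (m + Poly_Mapping.single i 1)"
proof (induction P rule: mpolynomial_induct)
  case (single k c)
  have "k - Poly_Mapping.single i 1 = m \<longleftrightarrow> k = m + Poly_Mapping.single i 1"
    if "Poly_Mapping.lookup k i \<noteq> 0"
  proof
    assume "k - Poly_Mapping.single i 1 = m"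
    then show "k = m + Poly_Mapping.single i 1"
      using that by (intro poly_mapping_eqI) (auto simp: lookup_add lookup_minus lookup_single when_def)
  qed auto
  then show ?case
    by (cases "Poly_Mapping.lookup k i = 0")
       (auto simp: partial_single lookup_single when_def lookup_add)
next
  case (add f g)
  then show ?case
    by (simp add: partial_add lookup_add ring_distribs)
qed

text \<open>Normal forms modulo \<open>trunc_ideal\<close>, to which the degree argument for the
  kernel applies.\<close>

definition trunc_reduced :: "('f::field, 'n) mpolynomial \<Rightarrow> bool" where
  "trunc_reduced P \<longleftrightarrow> (\<forall>m\<in>Poly_Mapping.keys P. \<forall>i. Poly_Mapping.lookup m i < CHAR('f))"

lemma trunc_reduced_add: "trunc_reduced P \<Longrightarrow> trunc_reduced Q \<Longrightarrow> trunc_reduced (P + Q)"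
  using keys_add[of P Q] by (auto simp: trunc_reduced_def)

lemma trunc_reduced_partial:
  fixes P :: "('f::field, 'n) mpolynomial"
  assumes "trunc_reduced P"
  shows "trunc_reduced (partial i P)"
  unfolding trunc_reduced_def
proof (intro ballI allI)
  fix m j
  assume "m \<in> Poly_Mapping.keys (partial i P)"
  then have "m + Poly_Mapping.single i 1 \<in> Poly_Mapping.keys P"
    by (auto simp: in_keys_iff lookup_partial)
  with assms have "Poly_Mapping.lookup (m + Poly_Mapping.single i 1) j < CHAR('f)"
    by (auto simp: trunc_reduced_def)
  then show "Poly_Mapping.lookup m j < CHAR('f)"
    by (simp add: lookup_add)
qed

text \<open>A monomial with some exponent at least p is a multiple of
  \<open>indet i ^ CHAR('f)\<close> and can be replaced by 0; every other monomial is already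
  reduced.\<close>

lemma trunc_ideal_reduce:
  fixes P :: "('f::field, 'n) mpolynomial"
  obtains Q where "trunc_reduced Q" "P - Q \<in> trunc_ideal"
proof -
  have "\<exists>Q. trunc_reduced Q \<and> P - Q \<in> trunc_ideal"
  proof (induction P rule: mpolynomial_induct)
    case (single m c)
    show ?case
    proof (cases "\<exists>i. CHAR('f) \<le> Poly_Mapping.lookup m i")
      case True
      then obtain i where i: "CHAR('f) \<le> Poly_Mapping.lookup m i" ..
      have "m = (m - Poly_Mapping.single i CHAR('f)) + Poly_Mapping.single i CHAR('f)"
        using i by (intro poly_mapping_eqI) (auto simp: lookup_add lookup_minus lookup_single when_def)
      then have "Poly_Mapping.single m c =
          Poly_Mapping.single (m - Poly_Mapping.single i CHAR('f)) c * indet i ^ CHAR('f)"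
        by (simp add: indet_power mult_single)
      also have "\<dots> \<in> trunc_ideal"
        by (rule trunc_ideal_closed) (auto simp: trunc_ideal_def intro: mpoly_ideal.span_base)
      finally have "Poly_Mapping.single m c - 0 \<in> trunc_ideal"
        by simp
      then show ?thesis
        by (intro exI[of _ 0]) (simp add: trunc_reduced_def)
    next
      case False
      then show ?thesis
        by (intro exI[of _ "Poly_Mapping.single m c"])
           (auto simp: trunc_reduced_def trunc_ideal_closed not_le)
    qed
  next
    case (add f g)
    then obtain Q Q' where "trunc_reduced Q" "trunc_reduced Q'" "f - Q \<in> trunc_ideal" "g - Q' \<in> trunc_ideal"
      by blast
    then show ?case
      by (intro exI[of _ "Q + Q'"]) (simp add: trunc_reduced_add add_diff_add trunc_ideal_closed)
  qed
  with that show thesis by blast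
qed

section \<open>Operators satisfying the Weyl relations\<close>

locale weyl_operators = vector_space scale
  for scale :: "'f::field \<Rightarrow> 'v::ab_group_add \<Rightarrow> 'v" +
  fixes A B :: "'n::finite \<Rightarrow> 'v \<Rightarrow> 'v" and \<alpha> :: 'f
  assumes A_add: "A i (u + v) = A i u + A i v"
    and A_scale: "A i (scale c v) = scale c (A i v)"
    and B_add: "B i (u + v) = B i u + B i v"
    and B_scale: "B i (scale c v) = scale c (B i v)"
    and A_commute: "A i (A j v) = A j (A i v)"
    and B_commute: "B i (B j v) = B j (B i v)"
    and A_B: "A i (B j v) = B j (A i v) + (if i = j then scale \<alpha> v else 0)"
begin

text \<open>Exchanging the two families reverses the commutator, hence the sign. Every fact about
  \<open>A\<close> thus yields one about \<open>B\<close>.\<close>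

lemma swap: "weyl_operators scale B A (- \<alpha>)"
  by unfold_locales (simp_all add: A_add A_scale B_add B_scale A_commute B_commute A_B)

lemma A_0 [simp]: "A i 0 = 0"
  using A_scale[of i 0 0] by simp

lemma B_0 [simp]: "B i 0 = 0"
  using B_scale[of i 0 0] by simp

lemma A_pow_0 [simp]: "(A i ^^ k) 0 = 0"
  by (induction k) simp_all

lemma B_pow_0 [simp]: "(B i ^^ k) 0 = 0"
  by (induction k) simp_all

lemma A_pow_add: "(A i ^^ k) (u + v) = (A i ^^ k) u + (A i ^^ k) v"
  by (induction k) (simp_all add: A_add)

lemma A_pow_scale: "(A i ^^ k) (scale c v) = scale c ((A i ^^ k) v)"
  by (induction k) (simp_all add: A_scale)

lemma A_pow_commute: "A j ((A i ^^ k) v) = (A i ^^ k) (A j v)"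
  by (induction k) (simp_all add: A_commute[of j i])

lemma B_pow_commute: "B j ((B i ^^ k) v) = (B i ^^ k) (B j v)"
  by (induction k) (simp_all add: B_commute[of j i])

lemma B_pow_pow_commute: "(B j ^^ l) ((B i ^^ k) v) = (B i ^^ k) ((B j ^^ l) v)"
  by (induction l) (simp_all add: B_pow_commute)

text \<open>The commutator with \<open>A i\<close> is a derivation, so on powers of
  \<open>B i\<close> it acts as \<alpha> times differentiation. For \<open>k = 0\<close> the
  truncated exponent \<open>k - 1\<close> is harmless, since its coefficient is 0.\<close>

lemma A_B_pow:
  "A i ((B j ^^ k) v) =
     (B j ^^ k) (A i v) + (if i = j then scale (\<alpha> * of_nat k) ((B j ^^ (k - 1)) v) else 0)"
proof (induction k)
  case (Suc k)
  have "B i (scale (\<alpha> * of_nat k) ((B i ^^ (k - 1)) v)) = scale (\<alpha> * of_nat k) ((B i ^^ k) v)"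
    by (cases k) (simp_all add: B_scale)
  with Suc show ?case
    by (auto simp: A_B B_add algebra_simps)
qed simp

text \<open>In the swapped form of \<open>A_B_pow\<close> the commutator carries the factor p, which
  is 0 in the field.\<close>

lemma B_A_pow_CHAR: "B j ((A i ^^ CHAR('f)) v) = (A i ^^ CHAR('f)) (B j v)"
  by (simp add: weyl_operators.A_B_pow[OF swap])

text \<open>Indices are added one at a time. The last nonzero power of \<open>A i\<close> applied to
  a common null vector \<open>v\<close> of the earlier operators is killed by \<open>A i\<close>,
  and still by the earlier ones because all \<open>A j\<close> commute.\<close>

lemma common_kernel:
  assumes nilpotent: "\<And>i v. (A i ^^ p) v = 0" and nontrivial: "(w :: 'v) \<noteq> 0"
  obtains v where "v \<noteq> 0" "\<And>i. A i v = 0"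
proof -
  have "\<exists>v. v \<noteq> 0 \<and> (\<forall>i\<in>S. A i v = 0)" if "finite S" for S
    using that
  proof induction
    case empty
    then show ?case using nontrivial by auto
  next
    case (insert i S)
    then obtain v where v: "v \<noteq> 0" "\<forall>j\<in>S. A j v = 0"
      by blast
    define k where "k = (LEAST k. (A i ^^ k) v = 0)"
    have k: "(A i ^^ k) v = 0"
      unfolding k_def by (rule LeastI, rule nilpotent)
    then obtain l where l: "k = Suc l"
      using v by (cases k) auto
    have "(A i ^^ l) v \<noteq> 0"
      using not_less_Least[of l "\<lambda>k. (A i ^^ k) v = 0"] l by (simp add: k_def)
    moreover have "A i ((A i ^^ l) v) = 0"
      using k l by simp
    moreover have "A j ((A i ^^ l) v) = 0" if "j \<in> S" for j
      using v that by (simp add: A_pow_commute)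
    ultimately show ?case
      by blast
  qed
  from this[of UNIV] that show thesis
    by auto
qed

section \<open>Evaluation of polynomials at the commuting operators\<close>

definition monomial_apply :: "('n \<Rightarrow>\<^sub>0 nat) \<Rightarrow> 'v \<Rightarrow> 'v" where
  "monomial_apply m v = Finite_Set.fold (\<lambda>i. B i ^^ Poly_Mapping.lookup m i) v UNIV"

text \<open>This is the vector P(B) v of the evaluation map.\<close>

definition poly_apply :: "('f, 'n) mpolynomial \<Rightarrow> 'v \<Rightarrow> 'v" where
  "poly_apply P v =
     (\<Sum>m\<in>Poly_Mapping.keys P. scale (Poly_Mapping.lookup P m) (monomial_apply m v))"

text \<open>Commutativity makes the fold in \<open>monomial_apply\<close> independent of the order
  of the indices.\<close>

lemma B_pow_comp_fun_commute: "comp_fun_commute_on UNIV (\<lambda>i. B i ^^ f i)"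
  by unfold_locales (auto simp: fun_eq_iff B_pow_pow_commute)

text \<open>With the factor of index \<open>i\<close> outermost, the remainder \<open>r i\<close>
  does not involve the exponent at \<open>i\<close>, so it survives any change of that
  exponent.\<close>

lemma monomial_apply_split:
  fixes m :: "'n \<Rightarrow>\<^sub>0 nat" and v :: 'v
  defines "r \<equiv> \<lambda>i. Finite_Set.fold (\<lambda>j. B j ^^ Poly_Mapping.lookup m j) v (UNIV - {i})"
  shows "monomial_apply m v = (B i ^^ Poly_Mapping.lookup m i) (r i)"
  unfolding monomial_apply_def r_def
  by (rule comp_fun_commute_on.fold_rec[OF B_pow_comp_fun_commute]) auto

lemma monomial_apply_0 [simp]: "monomial_apply 0 v = v"
proof -
  interpret comp_fun_commute "\<lambda>(i :: 'n) (u :: 'v). u"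
    by unfold_locales auto
  have "Finite_Set.fold (\<lambda>i. B i ^^ Poly_Mapping.lookup 0 i) v S = v" if "finite S" for S
    using that by induction auto
  then show ?thesis
    by (simp add: monomial_apply_def)
qed

lemma B_monomial_apply:
  "B i (monomial_apply m v) = monomial_apply (Poly_Mapping.single i 1 + m) v"
proof -
  have "Finite_Set.fold (\<lambda>j. B j ^^ Poly_Mapping.lookup (Poly_Mapping.single i 1 + m) j) v (UNIV - {i})
      = Finite_Set.fold (\<lambda>j. B j ^^ Poly_Mapping.lookup m j) v (UNIV - {i})"
    by (rule Finite_Set.fold_cong[OF B_pow_comp_fun_commute B_pow_comp_fun_commute])
       (auto simp: lookup_add lookup_single)
  then show ?thesis
    by (simp add: monomial_apply_split[of _ _ i] lookup_add)
qed

text \<open>\<open>A i\<close> passes through all factors of index other than \<open>i\<close> and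
  then kills \<open>v\<close>; only its commutator with the power of \<open>B i\<close>
  remains.\<close>

lemma A_monomial_apply:
  assumes "A i v = 0"
  shows "A i (monomial_apply m v) =
    scale (\<alpha> * of_nat (Poly_Mapping.lookup m i)) (monomial_apply (m - Poly_Mapping.single i 1) v)"
proof -
  let ?r = "\<lambda>m. Finite_Set.fold (\<lambda>j. B j ^^ Poly_Mapping.lookup m j) v"
  interpret comp_fun_commute "\<lambda>j. B j ^^ Poly_Mapping.lookup m j"
    unfolding comp_fun_commute_def' by (rule B_pow_comp_fun_commute)
  have "A i (?r m S) = 0" if "finite S" "i \<notin> S" for S
    using that by induction (auto simp: assms A_B_pow)
  then have "A i (?r m (UNIV - {i})) = 0"
    by simp
  moreover have "?r (m - Poly_Mapping.single i 1) (UNIV - {i}) = ?r m (UNIV - {i})"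
    by (rule Finite_Set.fold_cong[OF B_pow_comp_fun_commute B_pow_comp_fun_commute])
       (auto simp: lookup_minus lookup_single)
  ultimately show ?thesis
    by (simp add: monomial_apply_split[of _ _ i] A_B_pow lookup_minus)
qed

lemma poly_apply_superset:
  assumes "finite S" "Poly_Mapping.keys P \<subseteq> S"
  shows "poly_apply P v = (\<Sum>m\<in>S. scale (Poly_Mapping.lookup P m) (monomial_apply m v))"
  unfolding poly_apply_def
  by (rule sum.mono_neutral_left) (use assms in \<open>auto simp: in_keys_iff\<close>)

lemma poly_apply_single [simp]: "poly_apply (Poly_Mapping.single m c) v = scale c (monomial_apply m v)"
  by (subst poly_apply_superset[of "{m}"]) auto

lemma poly_apply_add: "poly_apply (P + Q) v = poly_apply P v + poly_apply Q v"
proof -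
  let ?S = "Poly_Mapping.keys P \<union> Poly_Mapping.keys Q"
  have "finite ?S" "Poly_Mapping.keys (P + Q) \<subseteq> ?S"
    by (auto simp: keys_add)
  then show ?thesis
    by (subst (1 2 3) poly_apply_superset[of ?S])
       (auto simp: lookup_add scale_left_distrib sum.distrib)
qed

lemma poly_apply_0 [simp]: "poly_apply 0 v = 0"
  by (simp add: poly_apply_def)

lemma poly_apply_diff: "poly_apply (P - Q) v = poly_apply P v - poly_apply Q v"
  using poly_apply_add[of "P - Q" Q v] by simp

lemma poly_apply_scale: "poly_apply (poly_scale c P) v = scale c (poly_apply P v)"
  by (induction P rule: mpolynomial_induct)
     (simp_all add: poly_scale_def mult_single ring_distribs poly_apply_add scale_right_distrib)

lemma poly_apply_indet: "poly_apply (indet i * P) v = B i (poly_apply P v)"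
  by (induction P rule: mpolynomial_induct)
     (simp_all add: indet_def mult_single ring_distribs poly_apply_add B_add B_scale B_monomial_apply)

lemma poly_apply_indet_power: "poly_apply (indet i ^ k * P) v = (B i ^^ k) (poly_apply P v)"
proof (induction k)
  case (Suc k)
  then show ?case
    by (simp only: power_Suc mult.assoc poly_apply_indet funpow.simps o_apply)
qed simp

text \<open>For \<alpha> \<noteq> 0 this makes the set of polynomials that annihilate
  \<open>v\<close> closed under partial derivatives.\<close>

lemma poly_apply_partial:
  assumes "A i v = 0"
  shows "scale \<alpha> (poly_apply (partial i P) v) = A i (poly_apply P v)"
proof (induction P rule: mpolynomial_induct)
  case (single m c)
  show ?case
    by (simp only: partial_single poly_apply_single A_scale A_monomial_apply[OF assms] scale_scale
        mult.assoc mult.commute mult.left_commute)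
next
  case (add P P')
  then show ?case
    by (simp add: partial_add poly_apply_add A_add scale_right_distrib)
qed

lemma poly_apply_trunc_ideal:
  assumes nilpotent: "\<And>i v. (B i ^^ CHAR('f)) v = 0" and "P \<in> trunc_ideal"
  shows "poly_apply P v = 0"
  using assms(2) unfolding trunc_ideal_def
proof (induction rule: mpoly_ideal.span_induct_alt)
  case (step c x y)
  then show ?case
    by (auto simp: poly_apply_add poly_apply_indet_power nilpotent mult.commute[of c])
qed simp

text \<open>Induction on a strict degree bound \<open>d\<close>: the derivatives of \<open>P\<close>
  are reduced, annihilate \<open>v\<close> and have lower degree, so they vanish. Then
  \<open>P\<close> is a constant, and it is 0 because \<open>v\<close> is not.\<close>

lemma reduced_poly_apply_eq_0:
  assumes "\<alpha> \<noteq> 0" "v \<noteq> 0" "\<And>i. A i v = 0"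
    and "trunc_reduced P" "poly_apply P v = 0"
  shows "P = 0"
proof -
  let ?deg = "\<lambda>m. \<Sum>i\<in>UNIV. Poly_Mapping.lookup m i"
  have "P = 0" if "trunc_reduced P" "poly_apply P v = 0" "\<forall>m\<in>Poly_Mapping.keys P. ?deg m < d" for P d
    using that
  proof (induction d arbitrary: P)
    case 0
    then have "Poly_Mapping.keys P = {}"
      by auto
    then show ?case
      by simp
  next
    case (Suc d)
    have partial: "partial i P = 0" for i
    proof (rule Suc.IH)
      show "trunc_reduced (partial i P)"
        using Suc.prems by (intro trunc_reduced_partial)
      show "poly_apply (partial i P) v = 0"
        using poly_apply_partial[of i v P] assms Suc.prems by simp
      show "\<forall>m\<in>Poly_Mapping.keys (partial i P). ?deg m < d"
      proof
        fix m
        assume "m \<in> Poly_Mapping.keys (partial i P)"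
        then have "m + Poly_Mapping.single i 1 \<in> Poly_Mapping.keys P"
          by (auto simp: in_keys_iff lookup_partial)
        with Suc.prems have "?deg (m + Poly_Mapping.single i 1) < Suc d"
          by blast
        then show "?deg m < d"
          by (simp add: lookup_add lookup_single sum.distrib when_def)
      qed
    qed
    \<comment> \<open>A positive exponent of \<open>m\<close> at \<open>i\<close>, times the nonzero
      coefficient at \<open>m\<close>, is a coefficient of \<open>partial i P\<close>, hence 0. So p
      divides that exponent, although it lies below p.\<close>
    have "m = 0" if m: "m \<in> Poly_Mapping.keys P" for m
    proof (rule poly_mapping_eqI, rule ccontr)
      fix i
      assume "Poly_Mapping.lookup m i \<noteq> Poly_Mapping.lookup 0 i"
      then have i: "Poly_Mapping.lookup m i > 0"
        by simp
      then have *: "m - Poly_Mapping.single i 1 + Poly_Mapping.single i 1 = m"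
        by (intro poly_mapping_eqI) (auto simp: lookup_add lookup_minus lookup_single when_def)
      have "of_nat (Poly_Mapping.lookup m i) * Poly_Mapping.lookup P m = 0"
        using lookup_partial[of i P "m - Poly_Mapping.single i 1"] i
        unfolding * by (simp add: partial lookup_minus del: of_nat_Suc)
      then have "CHAR('f) dvd Poly_Mapping.lookup m i"
        using m by (simp add: in_keys_iff of_nat_eq_0_iff_char_dvd)
      with i have "CHAR('f) \<le> Poly_Mapping.lookup m i"
        by (simp add: dvd_imp_le)
      with m Suc.prems(1) show False
        by (auto simp: trunc_reduced_def simp flip: not_le)
    qed
    then have P: "P = Poly_Mapping.single 0 (Poly_Mapping.lookup P 0)"
      by (intro poly_mapping_eqI) (auto simp: lookup_single when_def in_keys_iff)
    then have "scale (Poly_Mapping.lookup P 0) v = 0"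
      using Suc.prems(2) by (metis poly_apply_single monomial_apply_0)
    with P show ?case
      using \<open>v \<noteq> 0\<close> by simp
  qed
  \<comment> \<open>The sum of all degrees plus one is a crude strict bound that also covers
    \<open>P = 0\<close>.\<close>
  moreover have "\<forall>m\<in>Poly_Mapping.keys P. ?deg m < Suc (\<Sum>m\<in>Poly_Mapping.keys P. ?deg m)"
    by (auto simp: less_Suc_eq_le intro!: member_le_sum)
  ultimately show ?thesis
    using assms(4,5) by blast
qed

text \<open>The ideal annihilates \<open>v\<close>, so \<open>P\<close> may be replaced by a reduced
  \<open>Q\<close>, which must then be 0.\<close>

lemma poly_apply_eq_0_iff:
  assumes "\<alpha> \<noteq> 0" "v \<noteq> 0" "\<And>i. A i v = 0" "\<And>i v. (B i ^^ CHAR('f)) v = 0"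
  shows "poly_apply P v = 0 \<longleftrightarrow> P \<in> trunc_ideal"
proof
  assume P: "poly_apply P v = 0"
  obtain Q where Q: "trunc_reduced Q" "P - Q \<in> trunc_ideal"
    by (rule trunc_ideal_reduce)
  then have "poly_apply Q v = 0"
    using poly_apply_trunc_ideal[OF assms(4) Q(2), of v] P by (simp add: poly_apply_diff)
  with Q assms have "Q = 0"
    by (intro reduced_poly_apply_eq_0) auto
  with Q show "P \<in> trunc_ideal"
    by simp
qed (rule poly_apply_trunc_ideal[OF assms(4)])

end

section \<open>Consequences of irreducibility\<close>

locale irreducible_weyl_operators = weyl_operators scale A B \<alpha>
  for scale :: "'f::field \<Rightarrow> 'v::ab_group_add \<Rightarrow> 'v"
    and A B :: "'n::finite \<Rightarrow> 'v \<Rightarrow> 'v" and \<alpha> :: 'f +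
  assumes irreducible:
    "subspace W \<Longrightarrow> (\<And>i v. v \<in> W \<Longrightarrow> A i v \<in> W) \<Longrightarrow> (\<And>i v. v \<in> W \<Longrightarrow> B i v \<in> W) \<Longrightarrow>
       W = {0} \<or> W = UNIV"
begin

lemma irreducible_swap: "irreducible_weyl_operators scale B A (- \<alpha>)"
proof -
  interpret S: weyl_operators scale B A "- \<alpha>"
    by (rule swap)
  show ?thesis
    by unfold_locales (rule irreducible)
qed

text \<open>The p-th power of \<open>A i\<close> commutes with all \<open>A j\<close> and
  \<open>B j\<close>, so its kernel is invariant; it contains \<open>v\<close> and hence is the
  whole space.\<close>

lemma A_nilpotent:
  assumes "CHAR('f) > 0" "v \<noteq> 0" "A i v = 0"
  shows "(A i ^^ CHAR('f)) w = 0"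
proof -
  let ?W = "{v. (A i ^^ CHAR('f)) v = 0}"
  have "subspace ?W"
    by (auto simp: subspace_def A_pow_add A_pow_scale)
  then have "?W = {0} \<or> ?W = UNIV"
    by (rule irreducible) (auto simp: B_A_pow_CHAR[symmetric] A_pow_commute[symmetric])
  \<comment> \<open>Since p > 0, the power has an innermost factor \<open>A i\<close>, which kills
    \<open>v\<close>.\<close>
  moreover have "v \<in> ?W"
    using assms by (cases "CHAR('f)") (auto simp: funpow_Suc_right simp del: funpow.simps)
  ultimately show ?thesis
    using \<open>v \<noteq> 0\<close> by auto
qed

text \<open>The values at \<open>v\<close> form a subspace stable under \<open>B i\<close>
  (multiplication by an indeterminate) and \<open>A i\<close> (differentiation). It contains
  \<open>v\<close>, the value of the constant 1.\<close>

lemma poly_apply_surj: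
  assumes "v \<noteq> 0" "\<And>i. A i v = 0"
  shows "\<exists>P. poly_apply P v = w"
proof -
  let ?W = "range (\<lambda>P. poly_apply P v)"
  have "?W = {0} \<or> ?W = UNIV"
  proof (rule irreducible)
    show "subspace ?W"
      by (auto simp: subspace_def poly_apply_add[symmetric] poly_apply_scale[symmetric]
          intro: range_eqI[of _ _ 0])
    show "A i u \<in> ?W" if "u \<in> ?W" for i u
      using that assms by (auto simp: poly_apply_partial[symmetric] poly_apply_scale[symmetric])
    show "B i u \<in> ?W" if "u \<in> ?W" for i u
      using that by (auto simp: poly_apply_indet[symmetric])
  qed
  moreover have "poly_apply (Poly_Mapping.single 0 1) v = v"
    by (simp del: single_one)
  then have "v \<in> ?W"
    by (metis rangeI)
  ultimately have "w \<in> ?W"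
    using \<open>v \<noteq> 0\<close> by auto
  then show ?thesis
    by auto
qed

end

section \<open>The isomorphism with the truncated polynomial module\<close>

lemma rep_isomorphic_sym:
  assumes "vector_space scaleV" "vector_space scaleW" "rep_isomorphic scaleW S scaleV R"
  shows "rep_isomorphic scaleV R scaleW S"
proof -
  from assms(3) obtain \<phi> where lin: "Vector_Spaces.linear scaleW scaleV \<phi>" and "bij \<phi>"
    and \<phi>: "\<And>u v. \<phi> (S u v) = R u (\<phi> v)"
    unfolding rep_isomorphic_def by blast
  interpret Vector_Spaces.linear scaleW scaleV \<phi> by (rule lin)
  have [simp]: "\<phi> (inv \<phi> v) = v" "inv \<phi> (\<phi> w) = w" for v w
    using \<open>bij \<phi>\<close> by (simp_all add: bij_is_surj surj_f_inv_f bij_is_inj)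
  have inj: "v = w" if "\<phi> v = \<phi> w" for v w
    using \<open>bij \<phi>\<close> that by (simp add: bij_is_inj inj_eq)
  have "Vector_Spaces.linear scaleV scaleW (inv \<phi>)"
    unfolding Vector_Spaces.linear_iff by (auto intro!: assms inj simp: add scale)
  moreover have "inv \<phi> (R u v) = S u (inv \<phi> v)" for u v
    by (rule inj) (simp add: \<phi>)
  ultimately show ?thesis
    unfolding rep_isomorphic_def using \<open>bij \<phi>\<close> bij_imp_bij_inv by blast
qed

theorem theorem2p2:
  fixes scaleV :: "'f::field \<Rightarrow> 'v::ab_group_add \<Rightarrow> 'v"
    and R :: "('f, 'n::finite) heis \<Rightarrow> 'v \<Rightarrow> 'v"
    and \<alpha> :: 'f and \<beta> \<gamma> :: "'n \<Rightarrow> 'f"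
  assumes "prime CHAR('f)"
    and "lie_representation heis_scale heis_bracket scaleV R"
    and "lie_representation.faithful R"
    and "lie_representation.irreducible_rep scaleV R"
    and "lie_representation.finite_dimensional_rep scaleV"
    and "is_eigenvalue scaleV (R heis_z) \<alpha>"
    and "\<And>i. is_eigenvalue scaleV (R (heis_x i)) (\<beta> i)"
    and "\<And>i. is_eigenvalue scaleV (R (heis_y i)) (\<gamma> i)"
  shows "\<alpha> \<noteq> 0 \<and> rep_isomorphic scaleV R trunc_scale (trunc_act \<alpha> \<beta> \<gamma>)"
proof
  interpret lie_representation heis_scale heis_bracket scaleV R
    by (rule assms)
  interpret T: lie_representation heis_scale heis_bracket trunc_scale
    "trunc_act \<alpha> \<beta> \<gamma> :: ('f, 'n) heis \<Rightarrow> _"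
    by (rule trunc_act_representation)
  have R_add: "R u (v + w) = R u v + R u w" and R_scale: "R u (scaleV c v) = scaleV c (R u v)"
    for u v w c
    using rep_linear[of u] by (simp_all add: Vector_Spaces.linear_iff)
  have R_0 [simp]: "R u 0 = 0" "R 0 v = 0" for u v
    using R_add[of u 0 0] rep_add[of 0 0 v] by simp_all
  have R_diff: "R u (v - w) = R u v - R u w" for u v w
    using R_add[of u "v - w" w] by simp
  have R_commute: "R u (R w v) = R w (R u v) + R (heis_bracket u w) v" for u w v
    by (simp add: rep_bracket)
  have irreducible: "W = {0} \<or> W = UNIV" if "V.subspace W" "\<And>u v. v \<in> W \<Longrightarrow> R u v \<in> W" for W
    using assms(4) that by (auto simp: irreducible_rep_def invariant_subspace_def)

  \<comment> \<open>Since \<open>heis_z\<close> is central, its eigenspace for \<alpha> is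
    invariant.\<close>
  have z: "R heis_z v = scaleV \<alpha> v" for v
  proof -
    let ?W = "{v. R heis_z v = scaleV \<alpha> v}"
    have "?W = {0} \<or> ?W = UNIV"
    proof (rule irreducible)
      show "V.subspace ?W"
        by (auto simp: V.subspace_def R_add R_scale V.scale_right_distrib mult.commute)
      show "R u v \<in> ?W" if "v \<in> ?W" for u v
        using that R_commute[of heis_z u v] by (simp add: heis_bracket_basis R_scale)
    qed
    moreover have "?W \<noteq> {0}"
      using assms(6) by (auto simp: is_eigenvalue_def)
    ultimately show ?thesis
      by auto
  qed

  show alpha: "\<alpha> \<noteq> 0"
  proof
    assume "\<alpha> = 0"
    then have "R heis_z = R 0"
      by (simp add: fun_eq_iff z)
    then have "heis_z = (0 :: ('f, 'n) heis)"
      using assms(3) by (simp add: faithful_def inj_eq)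
    then show False
      by (simp add: heis_z_def zero_prod_def)
  qed

  \<comment> \<open>Subtracting scalars preserves commutators and turns the given eigenvectors into
    null vectors.\<close>
  define A where "A i v = R (heis_x i) v - scaleV (\<beta> i) v" for i v
  define B where "B i v = R (heis_y i) v - scaleV (\<gamma> i) v" for i v
  have x: "R (heis_x i) v = scaleV (\<beta> i) v + A i v" and y: "R (heis_y i) v = scaleV (\<gamma> i) v + B i v"
    for i v
    by (simp_all add: A_def B_def)
  interpret irreducible_weyl_operators scaleV A B \<alpha>
  proof
    show "A i (A j v) = A j (A i v)" for i j v
      using R_commute[of "heis_x i" "heis_x j" v]
      by (simp add: A_def R_diff R_scale heis_bracket_basis algebra_simps)
    show "B i (B j v) = B j (B i v)" for i j v
      using R_commute[of "heis_y i" "heis_y j" v]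
      by (simp add: B_def R_diff R_scale heis_bracket_basis algebra_simps)
    show "A i (B j v) = B j (A i v) + (if i = j then scaleV \<alpha> v else 0)" for i j v
      using R_commute[of "heis_x i" "heis_y j" v]
      by (auto simp: A_def B_def R_diff R_scale heis_bracket_basis z algebra_simps)
    \<comment> \<open>Each basis element acts as a scalar, plus some \<open>A i\<close> or
      \<open>B i\<close> unless it is \<open>heis_z\<close>, so stability under these operators
      gives invariance under \<open>R\<close>.\<close>
    show "W = {0} \<or> W = UNIV" if W: "V.subspace W"
      "\<And>i v. v \<in> W \<Longrightarrow> A i v \<in> W" "\<And>i v. v \<in> W \<Longrightarrow> B i v \<in> W" for W
    proof (rule irreducible)
      show "R u v \<in> W" if "v \<in> W" for u v
        by (induction u rule: heis_induct)
           (use W that in \<open>auto simp: x y z rep_add rep_scale V.subspace_add V.subspace_scale\<close>)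
    qed (rule W)
  qed (simp_all add: A_def B_def R_add R_scale V.scale_right_distrib V.scale_right_diff_distrib
        mult.commute algebra_simps)

  have p: "CHAR('f) > 0"
    using assms(1) by (simp add: prime_gt_0_nat)
  have A_nil: "(A i ^^ CHAR('f)) v = 0" for i v
    using assms(7)[of i] A_nilpotent[OF p] by (auto simp: is_eigenvalue_def A_def)
  have B_nil: "(B i ^^ CHAR('f)) v = 0" for i v
    using assms(8)[of i] irreducible_weyl_operators.A_nilpotent[OF irreducible_swap p]
    by (auto simp: is_eigenvalue_def B_def)
  obtain w :: 'v where "w \<noteq> 0"
    using assms(6) by (auto simp: is_eigenvalue_def)
  then obtain v0 where v0: "v0 \<noteq> 0" "\<And>i. A i v0 = 0"
    using common_kernel[OF A_nil] by blast
  have ker: "poly_apply P v0 = 0 \<longleftrightarrow> P \<in> trunc_ideal" for P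
    by (rule poly_apply_eq_0_iff[OF alpha v0 B_nil])

  \<comment> \<open>\<open>rep_trunc_poly\<close> picks an arbitrary representative; by
    \<open>ker\<close> the value does not depend on the choice.\<close>
  define \<psi> where "\<psi> q = poly_apply (rep_trunc_poly q) v0" for q
  have \<psi>: "\<psi> (abs_trunc_poly P) = poly_apply P v0" for P
  proof -
    have "trunc_rel (rep_trunc_poly (abs_trunc_poly P)) P"
      by (simp add: Quotient3_rel_rep trunc_poly.abs_eq_iff[symmetric] Quotient3_abs_rep[OF Quotient3_trunc_poly])
    then show ?thesis
      using ker[of "rep_trunc_poly (abs_trunc_poly P) - P"] by (simp add: trunc_rel_def \<psi>_def poly_apply_diff)
  qed
  \<comment> \<open>Linearity in \<open>u\<close> leaves only basis elements. Multiplication by an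
    indeterminate becomes \<open>B i\<close>, and \<alpha> times differentiation becomes
    \<open>A i\<close> because \<open>A i\<close> kills \<open>v0\<close>.\<close>
  have act: "poly_apply (poly_act \<alpha> \<beta> \<gamma> u P) v0 = R u (poly_apply P v0)" for u P
    by (induction u rule: heis_induct)
       (simp_all add: poly_act_basis poly_act_add_left poly_act_scale_left poly_apply_add
         poly_apply_scale poly_apply_indet poly_apply_partial v0 x y z rep_add rep_scale)
  have "rep_isomorphic trunc_scale (trunc_act \<alpha> \<beta> \<gamma>) scaleV R"
    unfolding rep_isomorphic_def
  proof (intro exI conjI allI)
    have "\<psi> (q + q') = \<psi> q + \<psi> q'" for q q'
      by (induction q rule: trunc_poly.abs_induct, induction q' rule: trunc_poly.abs_induct)
         (simp add: plus_trunc_poly.abs_eq \<psi> poly_apply_add)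
    moreover have "\<psi> (trunc_scale c q) = scaleV c (\<psi> q)" for c q
      by (induction q rule: trunc_poly.abs_induct)
         (simp add: trunc_scale.abs_eq \<psi> poly_apply_scale)
    ultimately show "Vector_Spaces.linear trunc_scale scaleV \<psi>"
      by (simp add: Vector_Spaces.linear_iff V.vector_space_axioms T.V.vector_space_axioms)
    have "q = q'" if "\<psi> q = \<psi> q'" for q q'
      using that
    proof (induction q rule: trunc_poly.abs_induct, induction q' rule: trunc_poly.abs_induct)
      fix P Q :: "('f, 'n) mpolynomial"
      assume "\<psi> (abs_trunc_poly P) = \<psi> (abs_trunc_poly Q)"
      then show "abs_trunc_poly P = abs_trunc_poly Q"
        using ker[of "P - Q"] by (simp add: \<psi> poly_apply_diff trunc_poly.abs_eq_iff trunc_rel_def)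
    qed
    moreover have "\<exists>q. v = \<psi> q" for v
      using poly_apply_surj[OF v0, of v] \<psi> by metis
    ultimately show "bij \<psi>"
      by (auto simp: bij_def inj_def surj_def)
    show "\<psi> (trunc_act \<alpha> \<beta> \<gamma> u q) = R u (\<psi> q)" for u q
      by (induction q rule: trunc_poly.abs_induct) (simp add: trunc_act.abs_eq \<psi> act)
  qed
  \<comment> \<open>\<open>\<psi>\<close> goes from the truncated module to \<open>V\<close>, so its
    inverse is the required map.\<close>
  then show "rep_isomorphic scaleV R trunc_scale (trunc_act \<alpha> \<beta> \<gamma>)"
    by (rule rep_isomorphic_sym[OF V.vector_space_axioms T.V.vector_space_axioms])
qed

end
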